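(* Let $G_5$ be the graph with vertex set $\{x,y_1,\dots,y_6,u_1,\dots,u_5,v_1,\dots,v_5\}$ and edge set $\{xy_i : i=1,\dots,6\}\cup\{y_iu_i,\ u_iv_i,\ v_iy_{i+1} : i=1,\dots,5\}$. Then $G_5$ is $(\frac{4}{2},2)^*$-colorable, but is not $(\frac{4}{2},1)^*$-colorable.
   Context: Graphs are finite, undirected and simple. For a positive integer $k$ and $i,j\in\{0,1,\dots,k-1\}$, the circular distance is $|i-j|_k=\min\{|i-j|,\,k-|i-j|\}$. For a nonnegative integer $t$, a $(\frac{k}{2},t)^*$-coloring of a graph $G$ is a mapping $f:V(G)\to\{0,1,\dots,k-1\}$ such that adjacent vertices receive different integers and, for each vertex $u$, the number of neighbors $v$ of $u$ with $|f(u)-f(v)|_k=1$ is at most $t$. $G$ is $(\frac{k}{2},t)^*$-colorable if it has such a coloring. (The symbol $\frac{k}{2}$ is formal notation recording the pair $(k,2)$, not a reduced fraction; so $\frac{4}{2}$ means $k=4$.) *)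

theory Defs
  imports "Graph_Theory.Graph_Theory"
begin

text \<open>
  A finite simple undirected graph is a \<^locale>\<open>pair_graph\<close>: an edge \<open>uv\<close> is represented by the
  two arcs \<open>(u, v)\<close> and \<open>(v, u)\<close>.
\<close>

definition circ_dist :: "nat \<Rightarrow> nat \<Rightarrow> nat \<Rightarrow> int" where
  "circ_dist k i j = min \<bar>int i - int j\<bar> (int k - \<bar>int i - int j\<bar>)"

text \<open>
  Below, \<open>k\<close> and \<open>t\<close> are the parameters of a \<open>(k/2, t)\<^sup>*\<close>-coloring. The denominator 2 is formal
  notation and is not represented.
\<close>

definition half_star_coloring :: "nat \<Rightarrow> nat \<Rightarrow> 'a pair_pre_digraph \<Rightarrow> ('a \<Rightarrow> nat) \<Rightarrow> bool" where
  "half_star_coloring k t G f \<longleftrightarrow>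
     (\<forall>u \<in> pverts G. f u \<in> {0..<k}) \<and>
     (\<forall>(u, v) \<in> parcs G. f u \<noteq> f v) \<and>
     (\<forall>u \<in> pverts G. card {v. (u, v) \<in> parcs G \<and> circ_dist k (f u) (f v) = 1} \<le> t)"

definition half_star_colorable :: "nat \<Rightarrow> nat \<Rightarrow> 'a pair_pre_digraph \<Rightarrow> bool" where
  "half_star_colorable k t G \<longleftrightarrow> (\<exists>f. half_star_coloring k t G f)"

datatype vertex = X | Y nat | U nat | V nat

definition G5_edges :: "(vertex \<times> vertex) set" where
  "G5_edges = {(X, Y i) | i. i \<in> {1..6}} \<union>
     (\<Union>i \<in> {1..5}. {(Y i, U i), (U i, V i), (V i, Y (i + 1))})"

definition G5 :: "vertex pair_pre_digraph" where
  "G5 = \<lparr>pverts = {X} \<union> Y ` {1..6} \<union> U ` {1..5} \<union> V ` {1..5},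
         parcs = G5_edges \<union> G5_edges\<inverse>\<rparr>"

lemma pair_graph_G5: "pair_graph G5"
proof
  have "{(X, Y i) | i. i \<in> {1..6}} = (\<lambda>i. (X, Y i)) ` {1..6}" by auto
  then have "finite G5_edges" unfolding G5_edges_def by auto
  then show "finite (parcs G5)" by (simp add: G5_def)
  show "finite (pverts G5)" by (simp add: G5_def)
  show "symmetric (with_proj G5)"
    by (auto simp: symmetric_def sym_def G5_def)
qed (auto simp: G5_def G5_edges_def)

end

theory Submission
  imports Defs
begin

text \<open>
  For four colors, a neighbor of \<open>x\<close> at circular distance other than 1 must get the color antipodal
  to that of \<open>x\<close>. With \<open>t = 1\<close> at most one \<open>y\<^sub>i\<close> is at distance 1, so \<open>y\<^sub>1, y\<^sub>2, y\<^sub>3\<close> or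
  \<open>y\<^sub>4, y\<^sub>5, y\<^sub>6\<close> have a common color. But if \<open>y\<^sub>i\<close> and \<open>y\<^sub>i\<^sub>+\<^sub>1\<close> agree, then \<open>u\<^sub>i\<close> and \<open>v\<^sub>i\<close> must be
  antipodal to each other, hence both are at distance 1 from that color; the middle one
  of three equal \<open>y\<close>'s therefore has two neighbors at distance 1. For \<open>t = 2\<close>, color
  \<open>x, y\<^sub>i, u\<^sub>i, v\<^sub>i\<close> by \<open>0, 2, 1, 3\<close>.
\<close>

text \<open>Differences 1 and 3 both give circular distance 1, differences 0 and 2 do not, so parity
  decides.\<close>

lemma circ_dist_4_eq_1_iff:
  assumes "i < 4" "j < 4"
  shows "circ_dist 4 i j = 1 \<longleftrightarrow> even i \<noteq> even j"
proof -
  have "i \<in> {0, 1, 2, 3}" "j \<in> {0, 1, 2, 3}" using assms by auto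
  then show ?thesis by (auto simp: circ_dist_def)
qed

text \<open>Only the antipode of \<open>a\<close> shares its parity and differs from it.\<close>

lemma eq_if_not_circ_dist_4_eq_1:
  assumes "a < 4" "b < 4" "c < 4" "b \<noteq> a" "c \<noteq> a"
    and "circ_dist 4 a b \<noteq> 1" "circ_dist 4 a c \<noteq> 1"
  shows "b = c"
proof -
  have "a \<in> {0, 1, 2, 3}" "b \<in> {0, 1, 2, 3}" "c \<in> {0, 1, 2, 3}" using assms by auto
  with assms show ?thesis by (auto simp: circ_dist_4_eq_1_iff)
qed

text \<open>Three distinct colors out of four contain exactly one antipodal pair, and the third is
  at distance 1 from both. The last two hypotheses keep \<open>b\<close> and \<open>c\<close> from
  being that third color.\<close>

lemma circ_dist_4_triangle:
  assumes "a < 4" "b < 4" "c < 4" "a \<noteq> b" "b \<noteq> c" "c \<noteq> a"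
    and "\<not> (circ_dist 4 b a = 1 \<and> circ_dist 4 b c = 1)"
    and "\<not> (circ_dist 4 c a = 1 \<and> circ_dist 4 c b = 1)"
  shows "circ_dist 4 a b = 1 \<and> circ_dist 4 a c = 1"
proof -
  have "a \<in> {0, 1, 2, 3}" "b \<in> {0, 1, 2, 3}" "c \<in> {0, 1, 2, 3}" using assms by auto
  with assms show ?thesis by (auto simp: circ_dist_4_eq_1_iff)
qed

lemma half_star_coloring_1_unique:
  assumes "pair_graph G" "half_star_coloring k 1 G f"
    and arcs: "(u, v) \<in> parcs G" "(u, w) \<in> parcs G"
    and dist: "circ_dist k (f u) (f v) = 1" "circ_dist k (f u) (f w) = 1"
  shows "v = w"
proof -
  interpret pair_graph G by fact
  let ?N = "{v. (u, v) \<in> parcs G \<and> circ_dist k (f u) (f v) = 1}"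
  \<comment> \<open>Finiteness comes first: \<open>card\<close> of an infinite set is 0, so the
    bound alone would say nothing.\<close>
  have "?N \<subseteq> snd ` parcs G" by force
  then have "finite ?N" by (rule finite_subset) simp
  moreover have "u \<in> pverts G" using arcs(1) by (auto dest: in_arcsD1)
  then have "card ?N \<le> Suc 0" using assms(2) by (simp add: half_star_coloring_def)
  ultimately have "\<forall>v\<in>?N. \<forall>w\<in>?N. v = w" by (simp only: card_le_Suc0_iff_eq)
  with arcs dist show ?thesis by simp
qed

lemma parcs_G5_XY: "i \<in> {1..6} \<Longrightarrow> (X, Y i) \<in> parcs G5"
  by (auto simp: G5_def G5_edges_def)

lemma parcs_G5_path:
  assumes "i \<in> {1..5}"
  shows "(Y i, U i) \<in> parcs G5" "(U i, Y i) \<in> parcs G5"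
    and "(U i, V i) \<in> parcs G5" "(V i, U i) \<in> parcs G5"
    and "(V i, Y (Suc i)) \<in> parcs G5" "(Y (Suc i), V i) \<in> parcs G5"
  using assms by (auto simp: G5_def G5_edges_def)

text \<open>With equal ends, the path from \<open>Y i\<close> to \<open>Y (Suc i)\<close> is colored
  like a triangle; the bound at \<open>U i\<close> and \<open>V i\<close> gives the last two
  hypotheses of \<open>circ_dist_4_triangle\<close>.\<close>

lemma G5_coloring_equal_Y:
  assumes col: "half_star_coloring 4 1 G5 f" and i: "i \<in> {1..5}"
    and eq: "f (Y (Suc i)) = f (Y i)"
  shows "circ_dist 4 (f (Y i)) (f (U i)) = 1 \<and> circ_dist 4 (f (Y i)) (f (V i)) = 1"
proof (rule circ_dist_4_triangle)
  note arcs = parcs_G5_path[OF i]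
  have lt: "\<And>w. w \<in> pverts G5 \<Longrightarrow> f w < 4"
    and ne: "\<And>v w. (v, w) \<in> parcs G5 \<Longrightarrow> f v \<noteq> f w"
    using col by (auto simp: half_star_coloring_def)
  show "f (Y i) < 4" "f (U i) < 4" "f (V i) < 4"
    using i by (auto intro!: lt simp: G5_def)
  show "f (Y i) \<noteq> f (U i)" "f (U i) \<noteq> f (V i)" "f (V i) \<noteq> f (Y i)"
    using ne[OF arcs(1)] ne[OF arcs(3)] ne[OF arcs(5)] eq by simp_all
  note uniq = half_star_coloring_1_unique[OF pair_graph_G5 col]
  show "\<not> (circ_dist 4 (f (U i)) (f (Y i)) = 1 \<and> circ_dist 4 (f (U i)) (f (V i)) = 1)"
    using uniq[OF arcs(2,3)] by auto
  show "\<not> (circ_dist 4 (f (V i)) (f (Y i)) = 1 \<and> circ_dist 4 (f (V i)) (f (U i)) = 1)"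
    using uniq[OF arcs(5,4)] eq by auto
qed

lemma G5_coloring_no_three_equal_Y:
  assumes col: "half_star_coloring 4 1 G5 f" and i: "i \<in> {1..4}"
    and eq: "f (Y (Suc i)) = f (Y i)" "f (Y (Suc (Suc i))) = f (Y (Suc i))"
  shows False
proof -
  have i': "i \<in> {1..5}" "Suc i \<in> {1..5}" using i by auto
  have "circ_dist 4 (f (Y (Suc i))) (f (V i)) = 1"
    using G5_coloring_equal_Y[OF col i'(1) eq(1)] eq(1) by simp
  moreover have "circ_dist 4 (f (Y (Suc i))) (f (U (Suc i))) = 1"
    using G5_coloring_equal_Y[OF col i'(2) eq(2)] by simp
  ultimately show False
    using half_star_coloring_1_unique[OF pair_graph_G5 col
        parcs_G5_path(6)[OF i'(1)] parcs_G5_path(1)[OF i'(2)]] by auto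
qed

lemma G5_not_4_1_colorable: "\<not> half_star_colorable 4 1 G5"
proof
  assume "half_star_colorable 4 1 G5"
  then obtain f where col: "half_star_coloring 4 1 G5 f"
    by (auto simp: half_star_colorable_def)
  let ?near = "\<lambda>i. circ_dist 4 (f X) (f (Y i)) = 1"
  have near: "i = j" if "i \<in> {1..6}" "j \<in> {1..6}" "?near i" "?near j" for i j
    using half_star_coloring_1_unique[OF pair_graph_G5 col parcs_G5_XY parcs_G5_XY] that by auto
  have eq: "f (Y i) = f (Y j)" if "i \<in> {1..6}" "j \<in> {1..6}" "\<not> ?near i" "\<not> ?near j" for i j
  proof (rule eq_if_not_circ_dist_4_eq_1[where a = "f X"])
    show "f X < 4" "f (Y i) < 4" "f (Y j) < 4"
      using col that by (auto simp: half_star_coloring_def G5_def)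
    show "f (Y i) \<noteq> f X" "f (Y j) \<noteq> f X"
      using col parcs_G5_XY[OF that(1)] parcs_G5_XY[OF that(2)]
      by (fastforce simp: half_star_coloring_def)+
  qed (use that in auto)
  \<comment> \<open>The triples starting at 1 and 4 are disjoint, so a single near index spoils at
    most one of them.\<close>
  have "\<exists>i\<in>{1, 4}. \<not> ?near i \<and> \<not> ?near (Suc i) \<and> \<not> ?near (Suc (Suc i))"
  proof (cases "?near 1 \<or> ?near 2 \<or> ?near 3")
    case True
    then obtain j where "j \<in> {1, 2, 3}" "?near j" by blast
    then have "\<not> ?near k" if "k \<in> {4..6}" for k
      using near[of j k] that by auto
    from this[of 4] this[of 5] this[of 6] show ?thesis by simp
  next
    case False
    then show ?thesis by (simp add: eval_nat_numeral)
  qed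
  then obtain i where i: "i \<in> {1, 4}"
    and far: "\<not> ?near i" "\<not> ?near (Suc i)" "\<not> ?near (Suc (Suc i))" by blast
  show False
  proof (rule G5_coloring_no_three_equal_Y[OF col])
    show "f (Y (Suc i)) = f (Y i)" "f (Y (Suc (Suc i))) = f (Y (Suc i))"
      using i far by (auto intro!: eq)
  qed (use i in auto)
qed

lemma G5_4_2_colorable: "half_star_colorable 4 2 G5"
proof -
  define f :: "vertex \<Rightarrow> nat" where
    "f w = (case w of X \<Rightarrow> 0 | Y _ \<Rightarrow> 2 | U _ \<Rightarrow> 1 | V _ \<Rightarrow> 3)" for w
  have f_simps: "f X = 0" "f (Y i) = 2" "f (U i) = 1" "f (V i) = 3" for i
    by (simp_all add: f_def)
  have dist: "circ_dist 4 (f v) (f w) = 1 \<longleftrightarrow> even (f v) \<noteq> even (f w)" for v w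
    by (rule circ_dist_4_eq_1_iff) (simp_all add: f_def split: vertex.split)
  have card: "card {w. (v, w) \<in> parcs G5 \<and> circ_dist 4 (f v) (f w) = 1} \<le> 2" for v
  proof -
    \<comment> \<open>Only edges between a \<open>Y\<close> and a \<open>U\<close> or
      \<open>V\<close> join colors of different parity. At the ends, \<open>V 0\<close> and
      \<open>U 6\<close> are not vertices of \<open>G5\<close>, which is harmless since
      \<open>M\<close> is only an upper bound.\<close>
    define M where "M = (case v of X \<Rightarrow> {} | Y i \<Rightarrow> {U i, V (i - 1)}
      | U i \<Rightarrow> {Y i} | V i \<Rightarrow> {Y (Suc i)})"
    have "{w. (v, w) \<in> parcs G5 \<and> circ_dist 4 (f v) (f w) = 1} \<subseteq> M"
      unfolding dist by (cases v) (auto simp: M_def f_simps G5_def G5_edges_def)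
    moreover have "finite M" "card M \<le> 2"
      by (auto simp: M_def card_insert_if split: vertex.split)
    ultimately show ?thesis by (meson card_mono order_trans)
  qed
  have "half_star_coloring 4 2 G5 f"
    unfolding half_star_coloring_def
  proof (intro conjI ballI card)
    show "f u \<in> {0..<4}" for u by (simp add: f_def split: vertex.split)
    show "case a of (u, v) \<Rightarrow> f u \<noteq> f v" if "a \<in> parcs G5" for a
      using that by (auto simp: G5_def G5_edges_def f_simps)
  qed
  then show ?thesis by (auto simp: half_star_colorable_def)
qed

theorem theorem5p1:
  shows "half_star_colorable 4 2 G5 \<and> \<not> half_star_colorable 4 1 G5"
  using G5_4_2_colorable G5_not_4_1_colorable by blast

end
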